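(* Let $f:\mathbb{R}^n\to\mathbb{R}$ be twice differentiable and bounded below, with $f_{\inf}:=\inf_x f(x)>-\infty$, with $L$-Lipschitz gradient and $M$-Lipschitz Hessian ($L,M>0$), and let $\epsilon>0$. Let $(x_k)_{k\ge 0}$ be generated by DRSOM from $x_0$ under the fixed-radius strategy $\Delta_k=\frac{2\sqrt{\epsilon}}{M}$ (every step accepted), and suppose that there is a constant $C\ge 0$ such that $\|(H_k-\tilde H_k)d_{k+1}\|\le C\|d_{k+1}\|^2$ for all $k$. Then DRSOM runs at most $O\!\left(\tfrac32 M^2\,(f(x_0)-f_{\inf})\,\epsilon^{-3/2}\right)$ iterations to reach an iterate $x_{k+1}$ that satisfies the first-order condition $$\|\nabla f(x_{k+1})\|\le \epsilon$$ and the approximated second-order condition in the subspace $\mathcal{L}_k$: $$V_kV_k^T H_{k+1}V_kV_k^T\succeq -3\sqrt{\epsilon}\,I ,$$ where the columns of $V_k$ form an orthonormal basis of $\mathcal{L}_k$.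
   Context: Notation: $\|\cdot\|$ is the Euclidean norm (and induced matrix norm), $g_k=\nabla f(x_k)$, $H_k=\nabla^2 f(x_k)$. Lipschitz assumptions: $\|\nabla f(x)-\nabla f(y)\|\le L\|x-y\|$ and $\|\nabla^2 f(x)-\nabla^2 f(y)\|\le M\|x-y\|$ for all $x,y\in\mathbb{R}^n$. DRSOM (Dimension-Reduced Second-Order Method) iteration: for $k\ge1$ put $d_k=x_k-x_{k-1}$, and put $d_0=0$. Let $\mathcal{L}_k=\mathrm{span}\{g_k,d_k\}$ and let $V_k$ be a matrix whose columns form an orthonormal basis of $\mathcal{L}_k$. Let $\alpha_k$ be a global solution of the trust-region subproblem $$\min_{\alpha}\ f(x_k)+\alpha^TV_k^Tg_k+\tfrac12\alpha^TV_k^TH_kV_k\alpha\quad\text{s.t. }\|\alpha\|\le\Delta_k,$$ with associated Lagrange multiplier $\lambda_k\ge 0$, i.e. $(V_k^TH_kV_k+\lambda_kI)\alpha_k=-V_k^Tg_k$, $V_k^TH_kV_k+\lambda_kI\succeq0$, $\lambda_k(\Delta_k-\|\alpha_k\|)=0$. Set $d_{k+1}=V_k\alpha_k$ and $x_{k+1}=x_k+d_{k+1}$. The projected (approximate) Hessian is $\tilde H_k=V_kV_k^TH_kV_kV_k^T$.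
   Formalization: The first-order condition is proved as ‖∇f(x_{k+1})‖ ≤ (4(M+C)/M²)ε, since "≤ ε" can fail: f(t)=½√(1+t²), M=½, ε=¼, x_0=1 gives iterates ±1 forever with |f'|≈0.354. The bound 3/2·M²(f(x_0)−f_inf)ε^{-3/2} is on the index k of x_{k+1}. *)

theory Defs
  imports "HOL-Analysis.Analysis"
begin

definition gradient :: "(real^'n \<Rightarrow> real) \<Rightarrow> real^'n \<Rightarrow> real^'n" where
  "gradient f x = (THE g. GDERIV f x :> g)"

definition hessian :: "(real^'n \<Rightarrow> real) \<Rightarrow> real^'n \<Rightarrow> real^'n^'n" where
  "hessian f x = matrix (frechet_derivative (gradient f) (at x))"

definition twice_differentiable :: "(real^'n \<Rightarrow> real) \<Rightarrow> bool" where
  "twice_differentiable f \<longleftrightarrow>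
     (\<forall>x. f differentiable (at x)) \<and> (\<forall>x. gradient f differentiable (at x))"

text \<open>Sanity facts: for a twice differentiable function the two selections above are the
  actual first and second derivatives.\<close>

lemma gderiv_gradient:
  fixes f :: "real^'n \<Rightarrow> real"
  assumes "f differentiable (at x)"
  shows "GDERIV f x :> gradient f x"
proof -
  from assms obtain f' where f': "(f has_derivative f') (at x)"
    unfolding differentiable_def by blast
  interpret linear f' using f' by (rule has_derivative_linear)
  have "f' h = h \<bullet> (\<Sum>b\<in>Basis. f' b *\<^sub>R b)" for h
  proof -
    have "f' h = f' (\<Sum>b\<in>Basis. (h \<bullet> b) *\<^sub>R b)"
      by (simp add: euclidean_representation)
    also have "\<dots> = h \<bullet> (\<Sum>b\<in>Basis. f' b *\<^sub>R b)"
      by (simp add: sum scale inner_sum_right mult.commute)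
    finally show ?thesis .
  qed
  with f' have g: "GDERIV f x :> (\<Sum>b\<in>Basis. f' b *\<^sub>R b)"
    unfolding gderiv_def by (metis (no_types, lifting) ext)
  have "D = E" if "GDERIV f x :> D" "GDERIV f x :> E" for D E
  proof -
    have "(\<lambda>h. h \<bullet> D) = (\<lambda>h. h \<bullet> E)"
      using that unfolding gderiv_def by (rule has_derivative_unique)
    then show ?thesis by (metis vector_eq_ldot)
  qed
  with g show ?thesis unfolding gradient_def by (metis theI)
qed

lemma has_derivative_gradient_hessian:
  fixes f :: "real^'n \<Rightarrow> real"
  assumes "gradient f differentiable (at x)"
  shows "(gradient f has_derivative (\<lambda>h. hessian f x *v h)) (at x)"
proof -
  have d: "(gradient f has_derivative frechet_derivative (gradient f) (at x)) (at x)"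
    using assms by (simp add: frechet_derivative_works)
  moreover have "(\<lambda>h. hessian f x *v h) = frechet_derivative (gradient f) (at x)"
    unfolding hessian_def using has_derivative_linear[OF d]
    by (simp add: matrix_works linear_matrix_vector_mul_eq)
  ultimately show ?thesis by simp
qed

text \<open>The norm of the type \<^typ>\<open>real^'n^'n\<close> is the Frobenius norm; the norm induced by the
  Euclidean vector norm is the operator norm.\<close>

definition induced_norm :: "real^'n^'n \<Rightarrow> real" where
  "induced_norm A = onorm (\<lambda>v. A *v v)"

definition loewner_le :: "real^'n^'n \<Rightarrow> real^'n^'n \<Rightarrow> bool" where
  "loewner_le A B \<longleftrightarrow> (\<forall>v. v \<bullet> (A *v v) \<le> v \<bullet> (B *v v))"

text \<open>The subspace spanned by the gradient and the previous step has dimension 0, 1 or 2,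
  depending on the iteration.  A matrix \<open>V\<close> with \<open>r\<close> columns in \<open>\<real>\<^sup>n\<close> is therefore
  represented by the list of its columns, and a vector of \<open>\<real>\<^sup>r\<close> (a matrix in
  \<open>\<real>\<^sup>r\<^sup>\<times>\<^sup>r\<close>) by a function of one index (two indices), of which only the values at indices
  below \<open>r = length V\<close> matter.  The Euclidean norm on \<open>\<real>\<^sup>r\<close> is \<^term>\<open>\<lambda>a. L2_set a {..<r}\<close>.\<close>

definition orthonormal_basis_of :: "(real^'n) list \<Rightarrow> (real^'n) set \<Rightarrow> bool" where
  "orthonormal_basis_of V S \<longleftrightarrow>
     (\<forall>i<length V. \<forall>j<length V. V ! i \<bullet> V ! j = (if i = j then 1 else 0)) \<and>
     span (set V) = S"

text \<open>\<open>V \<alpha>\<close>, \<open>V\<^sup>T g\<close>, \<open>V\<^sup>T H V\<close> and \<open>V V\<^sup>T\<close>.\<close>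

definition cols_mult :: "(real^'n) list \<Rightarrow> (nat \<Rightarrow> real) \<Rightarrow> real^'n" where
  "cols_mult V a = (\<Sum>i<length V. a i *\<^sub>R V ! i)"

definition reduced_vec :: "(real^'n) list \<Rightarrow> real^'n \<Rightarrow> nat \<Rightarrow> real" where
  "reduced_vec V g i = V ! i \<bullet> g"

definition reduced_mat :: "(real^'n) list \<Rightarrow> real^'n^'n \<Rightarrow> nat \<Rightarrow> nat \<Rightarrow> real" where
  "reduced_mat V H i j = V ! i \<bullet> (H *v V ! j)"

definition proj_mat :: "(real^'n) list \<Rightarrow> real^'n^'n" where
  "proj_mat V = (\<chi> p q. \<Sum>i<length V. (V ! i) $ p * (V ! i) $ q)"

definition projected_hessian :: "(real^'n) list \<Rightarrow> real^'n^'n \<Rightarrow> real^'n^'n" where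
  "projected_hessian V H = proj_mat V ** H ** proj_mat V"

text \<open>The quadratic \<open>c + a\<^sup>T b + 1/2 a\<^sup>T Q a\<close> on \<open>\<real>\<^sup>r\<close>, a global solution \<open>a\<close> of its minimization
  over the ball of radius \<open>\<Delta>\<close>, and a Lagrange multiplier \<open>l\<close> of that solution.\<close>

definition quad_model ::
  "nat \<Rightarrow> real \<Rightarrow> (nat \<Rightarrow> real) \<Rightarrow> (nat \<Rightarrow> nat \<Rightarrow> real) \<Rightarrow> (nat \<Rightarrow> real) \<Rightarrow> real" where
  "quad_model r c b Q a =
     c + (\<Sum>i<r. a i * b i) + 1/2 * (\<Sum>i<r. \<Sum>j<r. a i * Q i j * a j)"

definition tr_solution ::
  "nat \<Rightarrow> real \<Rightarrow> (nat \<Rightarrow> real) \<Rightarrow> (nat \<Rightarrow> nat \<Rightarrow> real) \<Rightarrow> real \<Rightarrow> (nat \<Rightarrow> real) \<Rightarrow> bool" where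
  "tr_solution r c b Q \<Delta> a \<longleftrightarrow>
     L2_set a {..<r} \<le> \<Delta> \<and>
     (\<forall>a'. L2_set a' {..<r} \<le> \<Delta> \<longrightarrow> quad_model r c b Q a \<le> quad_model r c b Q a')"

definition tr_multiplier ::
  "nat \<Rightarrow> (nat \<Rightarrow> real) \<Rightarrow> (nat \<Rightarrow> nat \<Rightarrow> real) \<Rightarrow> real \<Rightarrow> (nat \<Rightarrow> real) \<Rightarrow> real \<Rightarrow> bool" where
  "tr_multiplier r b Q \<Delta> a l \<longleftrightarrow>
     l \<ge> 0 \<and>
     (\<forall>i<r. (\<Sum>j<r. Q i j * a j) + l * a i = - b i) \<and>
     (\<forall>u. 0 \<le> (\<Sum>i<r. \<Sum>j<r. u i * Q i j * u j) + l * (\<Sum>i<r. (u i)\<^sup>2)) \<and>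
     l * (\<Delta> - L2_set a {..<r}) = 0"

definition drsom_dir :: "(nat \<Rightarrow> real^'n) \<Rightarrow> nat \<Rightarrow> real^'n" where
  "drsom_dir x k = (if k = 0 then 0 else x k - x (k - 1))"

text \<open>A run of the method on \<open>f\<close> with radii \<open>\<Delta>\<close>: iterates \<open>x\<close>, orthonormal bases \<open>V\<close> of the
  two-dimensional (or smaller) subspaces, subproblem solutions \<open>\<alpha>\<close>, multipliers \<open>l\<close>.
  Every trial step is accepted.\<close>

definition drsom_run ::
  "(real^'n \<Rightarrow> real) \<Rightarrow> (nat \<Rightarrow> real) \<Rightarrow> (nat \<Rightarrow> real^'n) \<Rightarrow> (nat \<Rightarrow> (real^'n) list) \<Rightarrow>
     (nat \<Rightarrow> nat \<Rightarrow> real) \<Rightarrow> (nat \<Rightarrow> real) \<Rightarrow> bool" where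
  "drsom_run f \<Delta> x V \<alpha> l \<longleftrightarrow>
     (\<forall>k. let g = gradient f (x k);
              b = reduced_vec (V k) g;
              Q = reduced_mat (V k) (hessian f (x k));
              r = length (V k)
          in orthonormal_basis_of (V k) (span {g, drsom_dir x k}) \<and>
             tr_solution r (f (x k)) b Q (\<Delta> k) (\<alpha> k) \<and>
             tr_multiplier r b Q (\<Delta> k) (\<alpha> k) (l k) \<and>
             x (Suc k) = x k + cols_mult (V k) (\<alpha> k))"

text \<open>With the fixed radius \<open>\<Delta> = 2 \<surd>\<epsilon> / M\<close> the order-\<open>\<epsilon>\<close> bound on the gradient carries a
  factor that depends on \<open>M\<close> and on the constant \<open>C\<close> of the Hessian approximation, and this
  factor cannot be replaced by 1: for \<open>f t = s \<surd>(1 + t\<^sup>2)\<close> on the real line with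
  \<open>0 < s < 1 / \<surd>2\<close>, \<open>M = s\<close> and \<open>\<epsilon> = s\<^sup>2\<close> one has \<open>\<Delta> = 2\<close> and \<open>C = 0\<close>, and the run started
  at 1 is \<open>1, -1, 1, -1, \<dots>\<close> with multiplier 0 and gradient norm
  \<open>s / \<surd>2 > \<epsilon>\<close> throughout.\<close>

end

theory Submission
  imports Defs
begin

text \<open>While the multiplier \<open>\<lambda>\<^sub>k\<close> exceeds \<open>\<surd>\<epsilon>\<close>, the step has full length
  \<open>\<Delta> = 2\<surd>\<epsilon>/M\<close>; the model then decreases by at least \<open>\<lambda>\<^sub>k\<Delta>\<^sup>2/2\<close>, which beats the cubic Taylor
  error \<open>M\<Delta>\<^sup>3/6\<close> by \<open>2\<epsilon>\<^sup>3\<^sup>/\<^sup>2/(3M\<^sup>2)\<close>. As \<open>f\<close> is bounded below, this bounds the first index with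
  \<open>\<lambda>\<^sub>k \<le> \<surd>\<epsilon>\<close>, and at that index both optimality conditions follow from the subproblem's
  optimality system and the Lipschitz Hessian.\<close>

section \<open>Projection onto the span of an orthonormal list\<close>

lemma mat_mult_vec:
  fixes v :: "real^'n"
  shows "mat c *v v = c *\<^sub>R v"
  by (simp add: vec_eq_iff matrix_vector_mult_def mat_def if_distrib[of "\<lambda>t. t * _"] cong: if_cong)

lemma cols_mult_inner:
  "cols_mult V a \<bullet> y = (\<Sum>i<length V. a i * (V ! i \<bullet> y))"
  by (simp add: cols_mult_def inner_sum_left)

lemma proj_mat_mult:
  "proj_mat V *v y = cols_mult V (reduced_vec V y)"
  unfolding proj_mat_def cols_mult_def reduced_vec_def
  by (simp add: vec_eq_iff matrix_vector_mult_def inner_vec_def sum_distrib_right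
      sum_distrib_left, subst sum.swap) (simp add: algebra_simps)

text \<open>Both sides are the sum of \<open>(V ! i \<bullet> u) * (V ! i \<bullet> y)\<close>,
  which is symmetric in \<open>u\<close> and \<open>y\<close>.\<close>

lemma inner_proj_mat:
  "u \<bullet> (proj_mat V *v y) = (proj_mat V *v u) \<bullet> y"
proof -
  have "u \<bullet> (proj_mat V *v y) = cols_mult V (reduced_vec V y) \<bullet> u"
    by (simp add: proj_mat_mult inner_commute)
  then show ?thesis
    by (simp add: proj_mat_mult cols_mult_inner reduced_vec_def mult.commute)
qed

lemma sum_reduced_mat:
  "(\<Sum>j<length V. reduced_mat V H i j * a j) = V ! i \<bullet> (H *v cols_mult V a)"
  unfolding reduced_mat_def cols_mult_def
  by (simp add: linear_sum[OF matrix_vector_mul_linear] inner_sum_right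
      matrix_vector_mult_scaleR mult.commute)

text \<open>Turns the semidefiniteness condition on the multiplier, stated on coefficients, into a
  statement on the curvature of \<open>H\<close> along vectors of the subspace.\<close>

lemma quadratic_reduced_mat:
  "(\<Sum>i<length V. \<Sum>j<length V. u i * reduced_mat V H i j * u j)
     = cols_mult V u \<bullet> (H *v cols_mult V u)"
proof -
  have "(\<Sum>i<length V. \<Sum>j<length V. u i * reduced_mat V H i j * u j)
      = (\<Sum>i<length V. u i * (\<Sum>j<length V. reduced_mat V H i j * u j))"
    by (simp add: sum_distrib_left mult.assoc)
  then show ?thesis
    by (simp add: sum_reduced_mat cols_mult_inner)
qed

lemma inner_col_cols_mult:
  assumes "orthonormal_basis_of V S" "i < length V"
  shows "V ! i \<bullet> cols_mult V a = a i"
proof -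
  have "V ! i \<bullet> cols_mult V a = (\<Sum>j<length V. a j * (V ! i \<bullet> V ! j))"
    by (simp add: cols_mult_def inner_sum_right)
  also have "\<dots> = (\<Sum>j<length V. if i = j then a j else 0)"
    using assms by (intro sum.cong) (auto simp: orthonormal_basis_of_def)
  also have "\<dots> = a i"
    using assms(2) by simp
  finally show ?thesis .
qed

lemma norm_cols_mult:
  assumes "orthonormal_basis_of V S"
  shows "norm (cols_mult V a) = L2_set a {..<length V}"
proof -
  have "cols_mult V a \<bullet> cols_mult V a = (\<Sum>i<length V. (a i)\<^sup>2)"
    by (simp add: cols_mult_inner inner_col_cols_mult[OF assms] power2_eq_square)
  then show ?thesis
    by (simp add: norm_eq_sqrt_inner L2_set_def)
qed

lemma proj_mat_cols_mult:
  assumes "orthonormal_basis_of V S"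
  shows "proj_mat V *v cols_mult V a = cols_mult V a"
  by (simp add: proj_mat_mult cols_mult_def reduced_vec_def
      inner_col_cols_mult[OF assms, unfolded cols_mult_def])

text \<open>The fixed points of the projection form a subspace, and each column is one, being
  \<open>cols_mult V\<close> of a unit coefficient vector. The lemma is meant for the gradient, a
  generator of the subspace of its iteration.\<close>

lemma proj_mat_idem_on_basis_span:
  assumes "orthonormal_basis_of V S" "y \<in> S"
  shows "proj_mat V *v y = y"
proof -
  have "y \<in> span (set V)"
    using assms by (simp add: orthonormal_basis_of_def)
  then show ?thesis
  proof (rule span_induct)
    show "subspace {y. proj_mat V *v y = y}"
      by (auto simp: subspace_def matrix_vector_right_distrib matrix_vector_mult_scaleR)
  next
    fix y assume "y \<in> set V"
    then obtain i where i: "i < length V" "y = V ! i"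
      by (metis in_set_conv_nth)
    have "cols_mult V (\<lambda>j. if j = i then 1 else 0)
        = (\<Sum>j<length V. if i = j then V ! j else 0)"
      unfolding cols_mult_def by (intro sum.cong) auto
    with i have "y = cols_mult V (\<lambda>j. if j = i then 1 else 0)"
      by simp
    then show "proj_mat V *v y = y"
      by (metis proj_mat_cols_mult[OF assms(1)])
  qed
qed

text \<open>Self-adjointness and idempotence give \<open>?p \<bullet> ?p = ?p \<bullet> y\<close>;
  Cauchy-Schwarz does the rest.\<close>

lemma norm_proj_mat_le:
  assumes "orthonormal_basis_of V S"
  shows "norm (proj_mat V *v y) \<le> norm y"
proof -
  let ?p = "proj_mat V *v y"
  have "?p \<bullet> ?p = ?p \<bullet> y"
    using inner_proj_mat[of ?p V y] proj_mat_cols_mult[OF assms, of "reduced_vec V y"]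
    by (simp add: proj_mat_mult)
  then have "norm ?p * norm ?p \<le> norm ?p * norm y"
    by (metis norm_cauchy_schwarz norm_eq_square power2_eq_square power2_norm_eq_inner)
  then show ?thesis
    by (cases "norm ?p = 0") (auto simp: mult_le_cancel_left_pos)
qed

lemma inner_projected_hessian:
  "u \<bullet> (projected_hessian V H *v y) = (proj_mat V *v u) \<bullet> (H *v (proj_mat V *v y))"
  by (simp add: projected_hessian_def inner_proj_mat flip: matrix_vector_mul_assoc)

section \<open>The optimality system of the subproblem, lifted to the full space\<close>

lemma tr_multiplier_stationary:
  assumes "orthonormal_basis_of V S"
    and "tr_multiplier (length V) (reduced_vec V g) (reduced_mat V H) \<Delta> a l"
  shows "proj_mat V *v (H *v cols_mult V a) = - (proj_mat V *v g) - l *\<^sub>R cols_mult V a"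
proof -
  \<comment> \<open>Row \<open>i\<close> of the reduced system is the coefficient of
    \<open>V ! i\<close>; recombining the columns then gives an identity between vectors of the full
    space.\<close>
  have "V ! i \<bullet> (H *v cols_mult V a) = - (V ! i \<bullet> g) - l * a i" if "i < length V" for i
    using assms(2) that unfolding tr_multiplier_def sum_reduced_mat reduced_vec_def
    by (simp add: eq_diff_eq)
  then have "proj_mat V *v (H *v cols_mult V a)
      = (\<Sum>i<length V. (- (V ! i \<bullet> g) - l * a i) *\<^sub>R V ! i)"
    unfolding proj_mat_mult reduced_vec_def cols_mult_def[of V "\<lambda>i. V ! i \<bullet> _"]
    by (intro sum.cong) auto
  then show ?thesis
    by (simp add: proj_mat_mult reduced_vec_def cols_mult_def[of V] scaleR_diff_left
        sum_subtractf sum_negf scaleR_sum_right)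
qed

lemma tr_multiplier_curvature:
  assumes "orthonormal_basis_of V S"
    and "tr_multiplier (length V) b (reduced_mat V H) \<Delta> a l"
  shows "- l * (norm (cols_mult V u))\<^sup>2 \<le> cols_mult V u \<bullet> (H *v cols_mult V u)"
proof -
  have "0 \<le> (\<Sum>i<length V. \<Sum>j<length V. u i * reduced_mat V H i j * u j)
      + l * (\<Sum>i<length V. (u i)\<^sup>2)"
    using assms(2) by (simp add: tr_multiplier_def)
  moreover have "(norm (cols_mult V u))\<^sup>2 = (\<Sum>i<length V. (u i)\<^sup>2)"
    by (simp add: norm_cols_mult[OF assms(1)] L2_set_def sum_nonneg)
  ultimately show ?thesis
    by (simp add: quadratic_reduced_mat)
qed

text \<open>Stationarity tested with \<open>d\<close> expresses \<open>g \<bullet> d\<close> through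
  the curvature, so the model change is
  \<open>- d \<bullet> (H *v d) / 2 - l * (norm d)\<^sup>2\<close>. The curvature bound gives back
  at most half of the last term.\<close>

lemma tr_multiplier_model_decrease:
  assumes ob: "orthonormal_basis_of V S"
    and tm: "tr_multiplier (length V) (reduced_vec V g) (reduced_mat V H) \<Delta> a l"
  defines "d \<equiv> cols_mult V a"
  shows "g \<bullet> d + d \<bullet> (H *v d) / 2 \<le> - l * (norm d)\<^sup>2 / 2"
proof -
  have Pd: "proj_mat V *v d = d"
    unfolding d_def by (rule proj_mat_cols_mult[OF ob])
  have "d \<bullet> (H *v d) = d \<bullet> (proj_mat V *v (H *v d))"
    by (simp add: inner_proj_mat Pd)
  also have "\<dots> = d \<bullet> (- (proj_mat V *v g) - l *\<^sub>R d)"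
    using tr_multiplier_stationary[OF ob tm] by (simp add: d_def)
  also have "\<dots> = - (g \<bullet> d) - l * (norm d)\<^sup>2"
    by (simp add: inner_diff_right inner_proj_mat Pd power2_norm_eq_inner inner_commute)
  finally have "d \<bullet> (H *v d) = - (g \<bullet> d) - l * (norm d)\<^sup>2" .
  moreover have "- l * (norm d)\<^sup>2 \<le> d \<bullet> (H *v d)"
    unfolding d_def by (rule tr_multiplier_curvature[OF ob tm])
  ultimately show ?thesis
    by (simp add: field_simps)
qed

section \<open>Taylor estimates from the Lipschitz Hessian\<close>

lemma norm_matrix_vector_le_induced_norm:
  "norm (A *v y) \<le> induced_norm A * norm y"
  unfolding induced_norm_def by (rule onorm[OF matrix_vector_mul_bounded_linear])

lemma inner_hessian_diff_le:
  assumes "induced_norm (A - B) \<le> m"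
  shows "u \<bullet> (A *v y - B *v y) \<le> m * norm y * norm u"
proof -
  have "u \<bullet> (A *v y - B *v y) \<le> norm u * norm ((A - B) *v y)"
    by (simp add: norm_cauchy_schwarz flip: matrix_vector_mult_diff_rdistrib)
  also have "\<dots> \<le> norm u * (m * norm y)"
    by (intro mult_left_mono order_trans[OF norm_matrix_vector_le_induced_norm]
        mult_right_mono assms) auto
  finally show ?thesis
    by (simp add: algebra_simps)
qed

context
  fixes f :: "real^'n \<Rightarrow> real" and M :: real
  assumes td: "twice_differentiable f"
    and lip: "\<And>y z. induced_norm (hessian f y - hessian f z) \<le> M * norm (y - z)"
begin

lemma inner_gradient_taylor:
  "u \<bullet> (gradient f (y + d) - gradient f y - hessian f y *v d) \<le> M / 2 * (norm d)\<^sup>2 * norm u"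
proof -
  \<comment> \<open>The subtracted quadratic has derivative
    \<open>M * t * (norm d)\<^sup>2 * norm u\<close>, the Lipschitz bound on the Hessian change
    after displacement \<open>t *\<^sub>R d\<close>.\<close>
  define h where "h t = u \<bullet> (gradient f (y + t *\<^sub>R d) - gradient f y - t *\<^sub>R (hessian f y *v d))
      - M / 2 * t\<^sup>2 * (norm d)\<^sup>2 * norm u" for t
  have "h 1 \<le> h 0"
  proof (rule DERIV_nonpos_imp_nonincreasing[of 0 1])
    fix t :: real
    assume t: "0 \<le> t" "t \<le> 1"
    let ?D = "u \<bullet> (hessian f (y + t *\<^sub>R d) *v d - hessian f y *v d)
        - M * t * (norm d)\<^sup>2 * norm u"
    have "gradient f differentiable (at (y + t *\<^sub>R d))"
      using td by (simp add: twice_differentiable_def)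
    note g' = has_derivative_gradient_hessian[OF this]
    have lin: "((\<lambda>t. y + t *\<^sub>R d) has_derivative (\<lambda>s. s *\<^sub>R d)) (at t)"
      by (auto intro!: derivative_eq_intros)
    have "(h has_derivative (\<lambda>s. ?D * s)) (at t)"
      unfolding h_def
      by (rule derivative_eq_intros has_derivative_compose[OF lin g'] refl)+
        (auto simp: fun_eq_iff algebra_simps inner_simps matrix_vector_mult_scaleR)
    then have "(h has_real_derivative ?D) (at t)"
      by (simp add: has_field_derivative_def)
    moreover have "?D \<le> 0"
      using inner_hessian_diff_le[OF lip[of "y + t *\<^sub>R d" y], of u d] t
      by (simp add: power2_eq_square algebra_simps)
    ultimately show "\<exists>D. (h has_real_derivative D) (at t) \<and> D \<le> 0"
      by blast
  qed simp
  then show ?thesis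
    by (simp add: h_def)
qed

text \<open>The tested estimate with \<open>u\<close> equal to the remainder itself; one factor of
  its norm cancels.\<close>

lemma norm_gradient_taylor:
  "norm (gradient f (y + d) - gradient f y - hessian f y *v d) \<le> M / 2 * (norm d)\<^sup>2"
proof -
  let ?r = "gradient f (y + d) - gradient f y - hessian f y *v d"
  have "norm ?r * norm ?r \<le> M / 2 * (norm d)\<^sup>2 * norm ?r"
    using inner_gradient_taylor[of ?r y d] by (simp add: power2_eq_square dot_square_norm)
  \<comment> \<open>The sign of \<open>M\<close> is not given here. It is recovered as far as
    needed: the Lipschitz bound between \<open>d\<close> and 0 dominates an operator norm.\<close>
  moreover have "0 \<le> M * norm d"
    using order_trans[OF onorm_pos_le[OF matrix_vector_mul_bounded_linear],
        of "hessian f d - hessian f 0"] lip[of d 0]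
    by (simp add: induced_norm_def)
  then have "0 \<le> M / 2 * (norm d)\<^sup>2"
    by (simp add: power2_eq_square flip: mult.assoc)
  ultimately show ?thesis
    by (cases "?r = 0") (auto dest: mult_right_le_imp_le)
qed

text \<open>The same monotonicity argument one order higher: the gradient estimate for
  \<open>t *\<^sub>R d\<close>, tested with \<open>d\<close>, bounds the derivative error by
  \<open>M / 2 * t\<^sup>2 * (norm d) ^ 3\<close>, whose antiderivative yields the factor
  \<open>M / 6\<close>.\<close>

lemma cubic_upper_bound:
  "f (y + d) \<le> f y + gradient f y \<bullet> d + d \<bullet> (hessian f y *v d) / 2 + M / 6 * (norm d) ^ 3"
proof -
  define h where "h t = f (y + t *\<^sub>R d) - t * (gradient f y \<bullet> d)
      - 1 / 2 * t\<^sup>2 * (d \<bullet> (hessian f y *v d)) - M / 6 * t ^ 3 * (norm d) ^ 3" for t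
  have "h 1 \<le> h 0"
  proof (rule DERIV_nonpos_imp_nonincreasing[of 0 1])
    fix t :: real
    assume t: "0 \<le> t" "t \<le> 1"
    let ?D = "d \<bullet> gradient f (y + t *\<^sub>R d) - gradient f y \<bullet> d
        - t * (d \<bullet> (hessian f y *v d)) - M / 2 * t\<^sup>2 * (norm d) ^ 3"
    have "f differentiable (at (y + t *\<^sub>R d))"
      using td by (simp add: twice_differentiable_def)
    note f' = gderiv_gradient[OF this, unfolded gderiv_def]
    have lin: "((\<lambda>t. y + t *\<^sub>R d) has_derivative (\<lambda>s. s *\<^sub>R d)) (at t)"
      by (auto intro!: derivative_eq_intros)
    have "(h has_derivative (\<lambda>s. ?D * s)) (at t)"
      unfolding h_def
      by (rule derivative_eq_intros has_derivative_compose[OF lin f'] refl)+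
        (auto simp: fun_eq_iff algebra_simps power2_eq_square)
    then have "(h has_real_derivative ?D) (at t)"
      by (simp add: has_field_derivative_def)
    moreover have "?D \<le> 0"
      using inner_gradient_taylor[of d y "t *\<^sub>R d"] t
      by (simp add: inner_simps matrix_vector_mult_scaleR power_mult_distrib
          power2_eq_square power3_eq_cube inner_commute algebra_simps)
    ultimately show "\<exists>D. (h has_real_derivative D) (at t) \<and> D \<le> 0"
      by blast
  qed simp
  then show ?thesis
    by (simp add: h_def)
qed

end

section \<open>Steps of the method and the iteration count\<close>

lemma drsom_step:
  assumes "drsom_run f \<Delta> x V \<alpha> l"
  shows "orthonormal_basis_of (V k) (span {gradient f (x k), drsom_dir x k})"
    and "tr_multiplier (length (V k)) (reduced_vec (V k) (gradient f (x k)))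
           (reduced_mat (V k) (hessian f (x k))) (\<Delta> k) (\<alpha> k) (l k)"
    and "x (Suc k) = x k + cols_mult (V k) (\<alpha> k)"
    and "norm (cols_mult (V k) (\<alpha> k)) \<le> \<Delta> k"
    and "l k > 0 \<Longrightarrow> norm (cols_mult (V k) (\<alpha> k)) = \<Delta> k"
proof -
  show ob: "orthonormal_basis_of (V k) (span {gradient f (x k), drsom_dir x k})"
    and tm: "tr_multiplier (length (V k)) (reduced_vec (V k) (gradient f (x k)))
           (reduced_mat (V k) (hessian f (x k))) (\<Delta> k) (\<alpha> k) (l k)"
    and "x (Suc k) = x k + cols_mult (V k) (\<alpha> k)"
    using assms unfolding drsom_run_def Let_def by auto
  show "norm (cols_mult (V k) (\<alpha> k)) \<le> \<Delta> k"
    using assms unfolding drsom_run_def Let_def norm_cols_mult[OF ob] tr_solution_def by auto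
  \<comment> \<open>Complementarity: a positive multiplier makes the radius constraint
    active.\<close>
  show "norm (cols_mult (V k) (\<alpha> k)) = \<Delta> k" if "l k > 0"
    using tm that unfolding tr_multiplier_def norm_cols_mult[OF ob] by auto
qed

text \<open>Every index before the first one satisfying \<open>P\<close> costs \<open>h\<close> at
  least \<open>\<delta>\<close>, while \<open>h\<close> stays above \<open>c\<close>. Without any
  such index, all natural numbers would obey the bound.\<close>

lemma first_index_bound:
  fixes h :: "nat \<Rightarrow> real"
  assumes "\<delta> > 0"
    and dec: "\<And>k. \<not> P k \<Longrightarrow> h (Suc k) \<le> h k - \<delta>"
    and low: "\<And>k. c \<le> h k"
  shows "\<exists>k. P k \<and> real k \<le> (h 0 - c) / \<delta>"
proof -
  have sum: "h n \<le> h 0 - real n * \<delta>" if "\<forall>k<n. \<not> P k" for n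
    using that
  proof (induction n)
    case (Suc n)
    then have "h (Suc n) \<le> h n - \<delta>" "h n \<le> h 0 - real n * \<delta>"
      using dec by auto
    then show ?case
      by (simp add: algebra_simps)
  qed simp
  then have le: "real n \<le> (h 0 - c) / \<delta>" if "\<forall>k<n. \<not> P k" for n
    using low[of n] sum[OF that] \<open>\<delta> > 0\<close> by (simp add: field_simps)
  have "\<exists>k. P k"
  proof (rule ccontr)
    assume "\<nexists>k. P k"
    then have "real n \<le> (h 0 - c) / \<delta>" for n
      using le by blast
    then show False
      using reals_Archimedean2[of "(h 0 - c) / \<delta>"] by (meson not_le)
  qed
  then show ?thesis
    using le[of "LEAST k. P k"] not_less_Least[of _ P] LeastI_ex[of P] by blast
qed

lemma drsom_decrease:
  assumes td: "twice_differentiable f"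
    and lip: "\<And>y z. induced_norm (hessian f y - hessian f z) \<le> M * norm (y - z)"
    and "M > 0" "\<epsilon> > 0"
    and run: "drsom_run f (\<lambda>k. 2 * sqrt \<epsilon> / M) x V \<alpha> l"
    and large: "l k > sqrt \<epsilon>"
  shows "f (x (Suc k)) \<le> f (x k) - 2 / 3 * (sqrt \<epsilon>) ^ 3 / M\<^sup>2"
proof -
  let ?d = "cols_mult (V k) (\<alpha> k)" and ?s = "sqrt \<epsilon>"
  have "?s > 0"
    using \<open>\<epsilon> > 0\<close> by simp
  then have nd: "norm ?d = 2 * ?s / M"
    using drsom_step(5)[OF run, of k] large by linarith
  have "f (x (Suc k)) \<le> f (x k) - l k * (norm ?d)\<^sup>2 / 2 + M / 6 * (norm ?d) ^ 3"
    using cubic_upper_bound[OF td lip, of "x k" ?d] drsom_step(3)[OF run]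
      tr_multiplier_model_decrease[OF drsom_step(1,2)[OF run], of k] by simp
  also have "\<dots> \<le> f (x k) - ?s * (norm ?d)\<^sup>2 / 2 + M / 6 * (norm ?d) ^ 3"
    using mult_right_mono[of ?s "l k" "(norm ?d)\<^sup>2"] large by simp
  \<comment> \<open>At this step length the decrease term is \<open>2 * ?s ^ 3 / M\<^sup>2\<close>
    and the cubic error is \<open>4 / 3 * ?s ^ 3 / M\<^sup>2\<close>.\<close>
  also have "\<dots> = f (x k) - 2 / 3 * ?s ^ 3 / M\<^sup>2"
    unfolding nd using \<open>M > 0\<close> by (simp add: field_simps power2_eq_square power3_eq_cube)
  finally show ?thesis .
qed

text \<open>The new gradient splits into the Taylor remainder, the Hessian approximation error along
  \<open>d\<close>, and the multiplier term \<open>- l k *\<^sub>R d\<close>; each is bounded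
  separately.\<close>

lemma drsom_gradient_bound:
  assumes td: "twice_differentiable f"
    and lip: "\<And>y z. induced_norm (hessian f y - hessian f z) \<le> M * norm (y - z)"
    and run: "drsom_run f \<Delta> x V \<alpha> l"
    and err: "norm ((hessian f (x k) - projected_hessian (V k) (hessian f (x k)))
                      *v drsom_dir x (Suc k)) \<le> C * (norm (drsom_dir x (Suc k)))\<^sup>2"
  defines "d \<equiv> cols_mult (V k) (\<alpha> k)"
  shows "norm (gradient f (x (Suc k))) \<le> (M / 2 + C) * (norm d)\<^sup>2 + l k * norm d"
proof -
  let ?g = "gradient f (x k)" and ?H = "hessian f (x k)" and ?P = "proj_mat (V k)"
  note ob = drsom_step(1)[OF run, of k] and tm = drsom_step(2)[OF run, of k]
  have x': "x (Suc k) = x k + d"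
    unfolding d_def by (rule drsom_step(3)[OF run])
  then have dir: "drsom_dir x (Suc k) = d"
    by (simp add: drsom_dir_def)
  \<comment> \<open>Stationarity controls only projected vectors. Since the gradient lies in the
    subspace, nothing of it is lost.\<close>
  have "?P *v ?g = ?g"
    by (rule proj_mat_idem_on_basis_span[OF ob]) (simp add: span_base)
  then have "projected_hessian (V k) ?H *v d = - ?g - l k *\<^sub>R d"
    using tr_multiplier_stationary[OF ob tm] proj_mat_cols_mult[OF ob, of "\<alpha> k"]
    by (simp add: projected_hessian_def d_def flip: matrix_vector_mul_assoc)
  then have "gradient f (x (Suc k)) = (gradient f (x k + d) - ?g - ?H *v d)
      + (?H - projected_hessian (V k) ?H) *v d - l k *\<^sub>R d"
    by (simp add: x' matrix_vector_mult_diff_rdistrib)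
  also have "norm \<dots> \<le> norm (gradient f (x k + d) - ?g - ?H *v d)
      + norm ((?H - projected_hessian (V k) ?H) *v d) + norm (l k *\<^sub>R d)"
    by (intro order_trans[OF norm_triangle_ineq4] add_right_mono norm_triangle_ineq)
  also have "\<dots> \<le> M / 2 * (norm d)\<^sup>2 + C * (norm d)\<^sup>2 + l k * norm d"
    using norm_gradient_taylor[OF td lip, of "x k" d] err tm
    by (simp add: dir tr_multiplier_def)
  finally show ?thesis
    by (simp add: algebra_simps)
qed

text \<open>On projected vectors the old Hessian has curvature at least \<open>- l k\<close>, and
  moving by \<open>d\<close> changes it by at most \<open>M * norm d\<close>.\<close>

lemma drsom_curvature_bound:
  fixes k :: nat
  assumes lip: "\<And>y z. induced_norm (hessian f y - hessian f z) \<le> M * norm (y - z)"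
    and "M \<ge> 0"
    and run: "drsom_run f \<Delta> x V \<alpha> l"
  defines "d \<equiv> cols_mult (V k) (\<alpha> k)"
  shows "loewner_le (mat (- (l k + M * norm d)))
           (projected_hessian (V k) (hessian f (x (Suc k))))"
  unfolding loewner_le_def
proof
  fix v
  let ?p = "proj_mat (V k) *v v" and ?H = "hessian f (x k)" and ?H' = "hessian f (x (Suc k))"
  note ob = drsom_step(1)[OF run, of k] and tm = drsom_step(2)[OF run, of k]
  let ?c = "l k + M * norm d"
  have "?c \<ge> 0"
    using tm \<open>M \<ge> 0\<close> by (simp add: tr_multiplier_def)
  have "norm (x k - x (Suc k)) = norm d"
    using drsom_step(3)[OF run, of k] by (simp add: d_def)
  then have "?p \<bullet> (?H *v ?p - ?H' *v ?p) \<le> M * norm d * norm ?p * norm ?p"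
    using inner_hessian_diff_le[OF lip[of "x k" "x (Suc k)"], of ?p ?p] by simp
  moreover have "- l k * (norm ?p)\<^sup>2 \<le> ?p \<bullet> (?H *v ?p)"
    using tr_multiplier_curvature[OF ob tm] by (simp add: proj_mat_mult)
  ultimately have "- ?c * (norm ?p)\<^sup>2 \<le> ?p \<bullet> (?H' *v ?p)"
    by (simp add: inner_diff_right algebra_simps power2_eq_square)
  \<comment> \<open>Passes from the subspace to all \<open>v\<close>; the sign of \<open>?c\<close>
    matters, as the projection can shrink \<open>v\<close>.\<close>
  moreover have "?c * (norm ?p)\<^sup>2 \<le> ?c * (norm v)\<^sup>2"
    using \<open>?c \<ge> 0\<close> norm_proj_mat_le[OF ob] by (intro mult_left_mono power_mono) auto
  ultimately show "v \<bullet> (mat (- ?c) *v v) \<le> v \<bullet> (projected_hessian (V k) ?H' *v v)"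
    unfolding mat_mult_vec inner_projected_hessian inner_scaleR_right power2_norm_eq_inner
    by linarith
qed

theorem theorem2:
  fixes f :: "real^'n \<Rightarrow> real"
    and L M C \<epsilon> :: real
    and x :: "nat \<Rightarrow> real^'n"
    and V :: "nat \<Rightarrow> (real^'n) list"
    and \<alpha> :: "nat \<Rightarrow> nat \<Rightarrow> real"
    and l :: "nat \<Rightarrow> real"
  assumes "twice_differentiable f"
    and "bdd_below (range f)"
    and "L > 0" and "M > 0" and "\<epsilon> > 0" and "C \<ge> 0"
    and "\<And>y z. norm (gradient f y - gradient f z) \<le> L * norm (y - z)"
    and "\<And>y z. induced_norm (hessian f y - hessian f z) \<le> M * norm (y - z)"
    and "drsom_run f (\<lambda>k. 2 * sqrt \<epsilon> / M) x V \<alpha> l"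
    and "\<And>k. norm ((hessian f (x k) - projected_hessian (V k) (hessian f (x k)))
                      *v drsom_dir x (Suc k))
               \<le> C * (norm (drsom_dir x (Suc k)))\<^sup>2"
  shows "\<exists>k. real k \<le> 3 / 2 * M\<^sup>2 * (f (x 0) - (INF y. f y)) * \<epsilon> powr (- 3 / 2) \<and>
             norm (gradient f (x (Suc k))) \<le> 4 * (M + C) / M\<^sup>2 * \<epsilon> \<and>
             loewner_le (mat (- 3 * sqrt \<epsilon>))
               (projected_hessian (V k) (hessian f (x (Suc k))))"
proof -
  let ?s = "sqrt \<epsilon>" and ?\<Delta> = "2 * sqrt \<epsilon> / M"
  note td = assms(1) and lip = assms(8) and run = assms(9) and err = assms(10)
  note pos = \<open>M > 0\<close> \<open>\<epsilon> > 0\<close>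
  \<comment> \<open>The guaranteed decrease while the multiplier exceeds \<open>?s\<close>; its
    reciprocal is the factor \<open>3 / 2 * M\<^sup>2 * \<epsilon> powr (- 3 / 2)\<close> of the
    count.\<close>
  define \<delta> where "\<delta> = 2 / 3 * ?s ^ 3 / M\<^sup>2"
  have "\<delta> > 0"
    using pos by (simp add: \<delta>_def)
  then obtain k where k: "l k \<le> ?s" "real k \<le> (f (x 0) - (INF y. f y)) / \<delta>"
    using first_index_bound[of \<delta> "\<lambda>k. l k \<le> ?s" "\<lambda>k. f (x k)" "INF y. f y"]
      drsom_decrease[OF td lip pos run] cINF_lower[OF assms(2)]
    by (auto simp: \<delta>_def not_le)
  have "\<epsilon> powr (- 3 / 2) = inverse (?s ^ 3)"
    using pos by (simp add: powr_minus powr_half_sqrt[symmetric] powr_realpow[symmetric] powr_powr)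
  then have count: "real k \<le> 3 / 2 * M\<^sup>2 * (f (x 0) - (INF y. f y)) * \<epsilon> powr (- 3 / 2)"
    using k(2) by (simp add: \<delta>_def field_simps)
  define d where "d = cols_mult (V k) (\<alpha> k)"
  have nd: "norm d \<le> ?\<Delta>"
    unfolding d_def by (rule drsom_step(4)[OF run])
  have "norm (gradient f (x (Suc k))) \<le> (M / 2 + C) * (norm d)\<^sup>2 + l k * norm d"
    unfolding d_def by (rule drsom_gradient_bound[OF td lip run err])
  also have "\<dots> \<le> (M / 2 + C) * ?\<Delta>\<^sup>2 + ?s * ?\<Delta>"
    using nd k(1) pos \<open>C \<ge> 0\<close> by (intro add_mono mult_mono power_mono) auto
  \<comment> \<open>The two summands are \<open>(2 * M + 4 * C) / M\<^sup>2 * \<epsilon>\<close> and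
    \<open>2 / M * \<epsilon>\<close>.\<close>
  also have "\<dots> = 4 * (M + C) / M\<^sup>2 * \<epsilon>"
    using pos by (simp add: field_simps power2_eq_square)
  finally have grad: "norm (gradient f (x (Suc k))) \<le> 4 * (M + C) / M\<^sup>2 * \<epsilon>" .
  have "M * norm d \<le> 2 * ?s"
    using nd pos by (simp add: field_simps)
  \<comment> \<open>The multiplier contributes one \<open>?s\<close>, the Hessian change over a step
    of at most the radius two more.\<close>
  with k(1) have c: "l k + M * norm d \<le> 3 * ?s"
    by simp
  have "loewner_le (mat (- 3 * ?s)) (mat (- (l k + M * norm d)) :: real^'n^'n)"
    unfolding loewner_le_def mat_mult_vec inner_scaleR_right
    using c by (intro allI mult_right_mono) auto
  then have "loewner_le (mat (- 3 * ?s)) (projected_hessian (V k) (hessian f (x (Suc k))))"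
    using drsom_curvature_bound[OF lip less_imp_le[OF \<open>M > 0\<close>] run, of k]
    unfolding loewner_le_def d_def by (blast intro: order_trans)
  with count grad show ?thesis
    by blast
qed

end
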